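(* Let $r\geq 2$ be an integer. Then for all integers $n \geq 3r^2$ and all real numbers $\alpha$ with $0\leq \alpha \leq 10^{-7}r^{-12}$ the following holds. Let $G$ be a $K_{r+1}$-free graph on $n$ vertices with $$e(G)\geq \mathrm{ex}(n,K_{r+1})-t,$$ where $t=\alpha n^2$. Then $$D_r(G)\leq \left(\frac{2r}{3\sqrt{3}} + 30r^3\alpha^{1/6} \right)\alpha^{3/2} n^2.$$
   Context: All graphs are finite and simple; $e(G)$ is the number of edges of $G$. $\mathrm{ex}(n,K_{r+1})$ denotes the Turán number, i.e. the maximum number of edges of a $K_{r+1}$-free graph on $n$ vertices. $D_r(G)$ denotes the minimum number of edges which need to be removed from $G$ to make it $r$-partite. *)

theory Defs
  imports Complex_Main "HOL-Library.Ramsey" "HOL-Library.Disjoint_Sets"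
begin

text \<open>
  A graph is a pair of a vertex set \<open>V\<close> and a set \<open>E\<close> of two-element subsets of \<open>V\<close>,
  as in the predicates \<^const>\<open>clique\<close> and \<^const>\<open>indep\<close> of \<^theory>\<open>HOL-Library.Ramsey\<close>.
\<close>

definition simple_graph :: "'a set \<Rightarrow> 'a set set \<Rightarrow> bool" where
  "simple_graph V E \<longleftrightarrow> finite V \<and> E \<subseteq> [V]\<^bsup>2\<^esup>"

definition clique_free :: "nat \<Rightarrow> 'a set \<Rightarrow> 'a set set \<Rightarrow> bool" where
  "clique_free k V E \<longleftrightarrow> \<not> (\<exists>K \<in> [V]\<^bsup>k\<^esup>. clique K E)"

text \<open>
  Taking the vertices from \<^typ>\<open>nat\<close> loses no graph up to isomorphism. For \<open>k \<ge> 2\<close>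
  the maximum is over a finite nonempty set (see \<open>turan_number_attained\<close>).
\<close>

definition turan_number :: "nat \<Rightarrow> nat \<Rightarrow> nat" where
  "turan_number n k =
     Max {card E | (V :: nat set) E. simple_graph V E \<and> card V = n \<and> clique_free k V E}"

text \<open>
  The blocks of \<^const>\<open>partition_on\<close> are nonempty, hence \<open>card P \<le> r\<close> rather than
  \<open>card P = r\<close>: parts of an \<open>r\<close>-partite graph may be empty.
\<close>

definition r_partite :: "nat \<Rightarrow> 'a set \<Rightarrow> 'a set set \<Rightarrow> bool" where
  "r_partite r V E \<longleftrightarrow> (\<exists>P. partition_on V P \<and> card P \<le> r \<and> (\<forall>X\<in>P. indep X E))"

definition partite_distance :: "nat \<Rightarrow> 'a set \<Rightarrow> 'a set set \<Rightarrow> nat" where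
  "partite_distance r V E = Min {card F | F. F \<subseteq> E \<and> r_partite r V (E - F)}"

lemma simple_graph_finite_edges:
  "simple_graph V E \<Longrightarrow> finite E"
  unfolding simple_graph_def by (meson finite_imp_finite_nsets finite_subset)

lemma simple_graph_card_edges_le:
  assumes "simple_graph V E"
  shows "card E \<le> card V choose 2"
  using assms unfolding simple_graph_def
  by (metis card_mono card_nsets finite_imp_finite_nsets)

lemma turan_number_candidates:
  fixes n k :: nat
  defines "S \<equiv> {card E | (V :: nat set) E. simple_graph V E \<and> card V = n \<and> clique_free k V E}"
  shows "finite S" and "k \<ge> 2 \<Longrightarrow> S \<noteq> {}"
proof -
  have "S \<subseteq> {..n choose 2}"
    unfolding S_def using simple_graph_card_edges_le by fastforce
  then show "finite S"
    by (rule finite_subset) simp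
next
  assume k: "k \<ge> 2"
  have "\<not> clique K {}" if "K \<in> [{..<n}]\<^bsup>k\<^esup>" for K
  proof -
    from that k have "card K \<ge> 2" by (simp add: nsets_def)
    then obtain x y where "x \<in> K" "y \<in> K" "x \<noteq> y"
      by (metis One_nat_def Suc_1 card_le_Suc0_iff_eq card.infinite not_less_eq_eq zero_le)
    then show ?thesis by (auto simp: clique_def)
  qed
  then have "clique_free k {..<n} {}"
    by (auto simp: clique_free_def)
  then have "card ({} :: nat set set) \<in> S"
    unfolding S_def simple_graph_def
    by (intro CollectI exI[of _ "{..<n}"] exI[of _ "{}"]) simp
  then show "S \<noteq> {}" by blast
qed

lemma turan_number_attained:
  assumes "k \<ge> 2"
  shows "\<exists>(V :: nat set) E. simple_graph V E \<and> card V = n \<and> clique_free k V E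
           \<and> card E = turan_number n k"
  using Max_in[OF turan_number_candidates(1) turan_number_candidates(2)[OF assms], of n]
  unfolding turan_number_def mem_Collect_eq by metis

lemma partite_distance_attained:
  assumes "simple_graph V E" "r \<ge> 1"
  shows "\<exists>F \<subseteq> E. r_partite r V (E - F) \<and> card F = partite_distance r V E"
proof -
  let ?S = "{card F | F. F \<subseteq> E \<and> r_partite r V (E - F)}"
  have "finite E" using assms(1) by (rule simple_graph_finite_edges)
  then have "?S \<subseteq> {..card E}" by (auto intro: card_mono)
  then have fin: "finite ?S" by (rule finite_subset) simp
  have "r_partite r V {}"
  proof (cases "V = {}")
    case True
    then show ?thesis
      by (auto simp: r_partite_def partition_on_def intro!: exI[of _ "{}"])
  next
    case False
    then have "partition_on V {V}" by (simp add: partition_on_def)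
    then show ?thesis
      using assms(2) by (auto simp: r_partite_def indep_def intro!: exI[of _ "{V}"])
  qed
  then have "card E \<in> ?S" by (intro CollectI exI[of _ E]) simp
  then have "Min ?S \<in> ?S" using fin by (intro Min_in) auto
  then show ?thesis unfolding partite_distance_def by auto
qed

end

theory Submission
  imports Defs
begin

text \<open>
  Fix a colouring \<open>f\<close> of the vertices with \<open>r\<close> colours that leaves as few monochromatic edges as
  possible. Let \<open>B\<close> be the set of monochromatic edges and \<open>M\<close> the set of non-adjacent pairs of
  vertices of different colours, the missing pairs. Deleting \<open>B\<close> makes the graph \<open>r\<close>-partite, so the task is to bound \<open>|B|\<close>.

  Furedi's greedy argument (\<open>furedi_colouring\<close>) gives some colouring with
  \<open>|E| + |B| \<le> e(K)\<close>, where \<open>K\<close> is the complete multipartite graph on its colour classes. As \<open>K\<close>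
  has at most Turan-many edges, \<open>|B| \<le> t\<close>, and this persists for the optimal \<open>f\<close>. Since
  \<open>e(K) = |E| - |B| + |M|\<close>, it follows that \<open>|M| \<le> t + |B| \<le> 2t\<close> and that all colour classes have
  size close to \<open>n/r\<close> (\<open>colour_class_near_average\<close>).

  Clique-freeness enters the rest only through one fact: if \<open>r\<close> (or \<open>r - 1\<close>) sets in different colour
  classes span no transversal clique, then the square of one of their sizes is at most the number
  of missing pairs inside them (\<open>exists_small_part_if_no_transversal_clique\<close>). Applied to
  the common neighbourhood of a monochromatic edge, it shows that one of the two endpoints is in many
  missing pairs, and that an endpoint whose partner is in few missing pairs is itself in almost
  \<open>n/r\<close> of them (\<open>monochromatic_edge_forces_missing_pairs\<close>). Applied to the neighbourhood of a
  single vertex that has \<open>d\<close> neighbours of its own colour, hence by optimality at least \<open>d\<close> of every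
  colour, it yields about \<open>d\<^sup>2\<close> missing pairs (\<open>monochromatic_degree_forces_missing_pairs\<close>).

  Put \<open>\<beta> = \<alpha>\<^sup>1\<^sup>/\<^sup>6\<close> and call a vertex bad if it is in more than \<open>\<beta>n\<close> missing pairs. There are only
  \<open>O(\<beta>\<^sup>5n)\<close> bad vertices, so edges of \<open>B\<close> between two of them number \<open>O(\<beta>\<^sup>1\<^sup>0n\<^sup>2)\<close>, which is of the order
  of the error term. Let \<open>k\<close> be the number of bad vertices joined by an edge of \<open>B\<close> to a good one, and
  let \<open>w\<^sup>2\<close> be the number of missing pairs without a bad vertex. Up to errors, \<open>|B| \<le> kw\<close>, whereas
  counting missing pairs gives \<open>kn/r + w\<^sup>2 \<le> t\<close>. Hence \<open>|B|\<close> is at most about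
  \<open>(r/n) w (t - w\<^sup>2)\<close>, whose maximum over \<open>w\<close>, at \<open>w\<^sup>2 = t/3\<close>, is
  \<open>(2r / (3 sqrt 3)) t\<^sup>3\<^sup>/\<^sup>2 / n\<close>, the claimed main term. The counting is
  \<open>optimal_colouring_inequalities\<close>, the optimisation \<open>extremal_estimate\<close>.
\<close>

section \<open>Complete multipartite graphs and double counting\<close>

text \<open>
  The edge set of the complete multipartite graph whose parts are the colour classes.
\<close>

definition cross_pairs :: "'a set \<Rightarrow> ('a \<Rightarrow> nat) \<Rightarrow> 'a set set" where
  "cross_pairs V f = {{x, y} | x y. x \<in> V \<and> y \<in> V \<and> f x \<noteq> f y}"

definition degree :: "'a set set \<Rightarrow> 'a \<Rightarrow> nat" where
  "degree F x = card {e \<in> F. x \<in> e}"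

definition colour_class :: "'a set \<Rightarrow> ('a \<Rightarrow> nat) \<Rightarrow> nat \<Rightarrow> 'a set" where
  "colour_class V f i = {v \<in> V. f v = i}"

lemma pair_in_cross_pairs_iff:
  "{x, y} \<in> cross_pairs V f \<longleftrightarrow> x \<in> V \<and> y \<in> V \<and> f x \<noteq> f y"
  unfolding cross_pairs_def by (auto simp: doubleton_eq_iff)

lemma nsets_2_cases:
  assumes "e \<in> F" "F \<subseteq> [V]\<^bsup>2\<^esup>"
  obtains x y where "e = {x, y}" "x \<in> V" "y \<in> V" "x \<noteq> y"
  using assms by (auto simp: nsets_def card_2_iff)

lemma cross_pairs_subset: "cross_pairs V f \<subseteq> [V]\<^bsup>2\<^esup>"
  by (auto simp: cross_pairs_def)

lemma finite_cross_pairs: "finite V \<Longrightarrow> finite (cross_pairs V f)"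
  by (meson cross_pairs_subset finite_imp_finite_nsets finite_subset)

lemma finite_subset_nsets_2: "finite V \<Longrightarrow> F \<subseteq> [V]\<^bsup>2\<^esup> \<Longrightarrow> finite F"
  by (meson finite_imp_finite_nsets finite_subset)

lemma degree_eq_card_neighbours:
  assumes "F \<subseteq> [V]\<^bsup>2\<^esup>"
  shows "degree F x = card {y. {x, y} \<in> F}"
proof -
  have "bij_betw (\<lambda>y. {x, y}) {y. {x, y} \<in> F} {e \<in> F. x \<in> e}"
    unfolding bij_betw_def
  proof
    show "inj_on (\<lambda>y. {x, y}) {y. {x, y} \<in> F}"
      by (auto simp: inj_on_def doubleton_eq_iff)
    show "(\<lambda>y. {x, y}) ` {y. {x, y} \<in> F} = {e \<in> F. x \<in> e}"
    proof (intro equalityI subsetI)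
      fix e assume e: "e \<in> {e \<in> F. x \<in> e}"
      then obtain a b where "e = {a, b}" using assms nsets_2_cases by (metis mem_Collect_eq)
      with e show "e \<in> (\<lambda>y. {x, y}) ` {y. {x, y} \<in> F}"
        by (auto simp: insert_commute)
    qed auto
  qed
  then show ?thesis unfolding degree_def by (rule bij_betw_same_card[symmetric])
qed

text \<open>
  Double counting of incidences. With \<open>U\<close> a proper subset of the vertices, an edge is weighted by
  the number of its endpoints in \<open>U\<close>; this weight is what tells monochromatic edges
  from crossing ones in Furedi's argument.
\<close>

lemma sum_degree:
  assumes "finite U" "finite F"
  shows "(\<Sum>x\<in>U. degree F x) = (\<Sum>e\<in>F. card (e \<inter> U))"
proof -
  have "(\<Sum>x\<in>U. degree F x) = (\<Sum>x\<in>U. \<Sum>e\<in>F. if x \<in> e then 1 else 0)"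
    unfolding degree_def using assms by (simp add: sum.If_cases Int_def)
  also have "\<dots> = (\<Sum>e\<in>F. \<Sum>x\<in>U. if x \<in> e then 1 else 0)"
    by (rule sum.swap)
  also have "\<dots> = (\<Sum>e\<in>F. card (e \<inter> U))"
    using assms by (simp add: sum.If_cases Int_def conj_commute)
  finally show ?thesis .
qed

lemma handshake:
  assumes "finite V" "F \<subseteq> [V]\<^bsup>2\<^esup>"
  shows "(\<Sum>x\<in>V. degree F x) = 2 * card F"
proof -
  have "card (e \<inter> V) = 2" if "e \<in> F" for e
    using that assms(2) by (auto simp: nsets_def Int_absorb2)
  then show ?thesis
    using sum_degree[OF assms(1) finite_subset_nsets_2[OF assms]] by simp
qed

lemma degree_cross_pairs:
  assumes "finite V" "x \<in> V"
  shows "degree (cross_pairs V f) x + card (colour_class V f (f x)) = card V"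
proof -
  have "{y. {x, y} \<in> cross_pairs V f} = V - colour_class V f (f x)"
    using assms by (auto simp: pair_in_cross_pairs_iff colour_class_def)
  moreover have "colour_class V f (f x) \<subseteq> V" by (auto simp: colour_class_def)
  ultimately show ?thesis
    using degree_eq_card_neighbours[OF cross_pairs_subset] assms
    by (metis add.commute card_Diff_subset card_mono finite_subset le_add_diff_inverse)
qed

lemma card_cross_pairs:
  assumes "finite V" "f ` V \<subseteq> {..<r}"
  shows "2 * card (cross_pairs V f) + (\<Sum>i<r. (card (colour_class V f i))\<^sup>2) = (card V)\<^sup>2"
proof -
  let ?c = "\<lambda>i. card (colour_class V f i)"
  have "(\<Sum>i<r. (?c i)\<^sup>2) = (\<Sum>i<r. \<Sum>x\<in>{x \<in> V. f x = i}. ?c (f x))"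
  proof (rule sum.cong)
    fix i
    have "(\<Sum>x\<in>{x \<in> V. f x = i}. ?c (f x)) = (\<Sum>x\<in>colour_class V f i. ?c i)"
      by (rule sum.cong) (auto simp: colour_class_def)
    also have "\<dots> = (?c i)\<^sup>2" by (simp add: power2_eq_square)
    finally show "(?c i)\<^sup>2 = (\<Sum>x\<in>{x \<in> V. f x = i}. ?c (f x))" ..
  qed simp
  also have "\<dots> = (\<Sum>x\<in>V. ?c (f x))"
    using assms by (intro sum.group) auto
  finally have "2 * card (cross_pairs V f) + (\<Sum>i<r. (?c i)\<^sup>2)
      = (\<Sum>x\<in>V. degree (cross_pairs V f) x + ?c (f x))"
    using handshake[OF assms(1) cross_pairs_subset, of f] by (simp add: sum.distrib)
  also have "\<dots> = (\<Sum>x\<in>V. card V)"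
    using degree_cross_pairs[OF assms(1)] by (intro sum.cong) auto
  finally show ?thesis by (simp add: power2_eq_square)
qed

lemma sum_card_colour_classes:
  assumes "finite V" "f ` V \<subseteq> {..<r}"
  shows "(\<Sum>i<r. card (colour_class V f i)) = card V"
proof -
  have "(\<Sum>i<r. \<Sum>x\<in>{x \<in> V. f x = i}. 1) = (\<Sum>x\<in>V. 1::nat)"
    using assms by (intro sum.group) auto
  then show ?thesis by (simp add: colour_class_def)
qed

section \<open>Colourings and the Turan number\<close>

text \<open>
  The Turan number maximises over graphs with natural numbers as vertices; an enumeration of \<open>V\<close>
  carries any other finite graph, and cliques back from it, to such a graph.
\<close>

lemma card_edges_le_turan_number:
  fixes V :: "'a set"
  assumes "simple_graph V E" "clique_free k V E"
  shows "card E \<le> turan_number (card V) k"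
proof -
  have finV: "finite V" and EV: "E \<subseteq> [V]\<^bsup>2\<^esup>"
    using assms(1) by (auto simp: simple_graph_def)
  obtain g where g: "bij_betw g V {..<card V}"
    using ex_bij_betw_finite_nat[OF finV] by (auto simp: lessThan_atLeast0)
  have inj: "inj_on g V" and img: "g ` V = {..<card V}"
    using g by (auto simp: bij_betw_def)
  let ?E = "(`) g ` E"
  have inj': "inj_on ((`) g) (Pow V)"
    using inj by (simp add: inj_on_image_Pow)
  have cardE: "card ?E = card E"
    by (intro card_image inj_on_subset[OF inj']) (use EV in \<open>auto simp: nsets_def\<close>)
  have sub: "?E \<subseteq> [{..<card V}]\<^bsup>2\<^esup>"
  proof
    fix e assume "e \<in> ?E"
    then obtain x y where "e = g ` {x, y}" "x \<in> V" "y \<in> V" "x \<noteq> y"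
      using EV nsets_2_cases by (metis (no_types, lifting) imageE)
    then show "e \<in> [{..<card V}]\<^bsup>2\<^esup>"
      using inj img by (auto simp: inj_on_def)
  qed
  have cf: "clique_free k {..<card V} ?E"
    unfolding clique_free_def
  proof (safe)
    fix K assume K: "K \<in> [{..<card V}]\<^bsup>k\<^esup>" and cl: "clique K ?E"
    let ?L = "{v \<in> V. g v \<in> K}"
    have gL: "g ` ?L = K" using K img by (auto simp: nsets_def)
    have "card ?L = k"
      using K gL card_image[of g ?L] inj_on_subset[OF inj, of ?L] by (auto simp: nsets_def)
    then have "?L \<in> [V]\<^bsup>k\<^esup>" using finV by (auto simp: nsets_def)
    moreover have "clique ?L E"
      unfolding clique_def
    proof (intro ballI impI)
      fix v w assume v: "v \<in> ?L" and w: "w \<in> ?L" and "v \<noteq> w"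
      then have "g v \<noteq> g w" using inj by (auto simp: inj_on_def)
      then have "{g v, g w} \<in> ?E" using cl v w by (auto simp: clique_def)
      then obtain e where e: "e \<in> E" "g ` {v, w} = g ` e" by auto
      have "e \<subseteq> V" using e EV by (auto simp: nsets_def)
      then have "{v, w} = e" using inj' e v w by (auto dest!: inj_onD[where x="{v,w}" and y=e])
      with e show "{v, w} \<in> E" by simp
    qed
    ultimately show False using assms(2) by (auto simp: clique_free_def)
  qed
  have "card E \<in> {card E | (V' :: nat set) E. simple_graph V' E \<and> card V' = card V \<and> clique_free k V' E}"
    using sub cf cardE by (intro CollectI exI[of _ "{..<card V}"] exI[of _ ?E]) (auto simp: simple_graph_def)
  then show ?thesis
    unfolding turan_number_def using turan_number_candidates(1) by (intro Max_ge) auto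
qed

text \<open>
  A clique meets every colour class at most once.
\<close>

lemma clique_free_cross_pairs:
  assumes "f ` V \<subseteq> {..<r}"
  shows "clique_free (r + 1) V (cross_pairs V f)"
  unfolding clique_free_def
proof safe
  fix K assume K: "K \<in> [V]\<^bsup>(r + 1)\<^esup>" and cl: "clique K (cross_pairs V f)"
  have "inj_on f K"
    using cl by (auto simp: inj_on_def clique_def pair_in_cross_pairs_iff)
  then have "card K \<le> card {..<r}"
    using K assms by (intro card_inj_on_le[of f]) (auto simp: nsets_def)
  then show False using K by (simp add: nsets_def)
qed

lemma card_cross_pairs_le_turan_number:
  assumes "finite V" "f ` V \<subseteq> {..<r}"
  shows "card (cross_pairs V f) \<le> turan_number (card V) (r + 1)"
  using assms cross_pairs_subset[of V f]
  by (intro card_edges_le_turan_number clique_free_cross_pairs) (auto simp: simple_graph_def)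

text \<open>
  Furedi's proof of stability. Let \<open>x\<close> have maximum degree. Its neighbourhood \<open>W\<close> contains no
  \<open>K\<^sub>r\<close> if the graph contains no \<open>K\<^sub>r\<^sub>+\<^sub>1\<close>, so it is coloured by induction, and the complement
  \<open>U\<close> of \<open>W\<close> receives one new colour. All degrees are at most \<open>|W|\<close>, so the degree sum over \<open>U\<close> is
  at most \<open>|U| |W|\<close>, the number of pairs between \<open>U\<close> and \<open>W\<close>. That degree sum counts the
  edges meeting \<open>U\<close>, those inside \<open>U\<close> (the new monochromatic ones) twice.
\<close>

lemma furedi_colouring:
  assumes "simple_graph V E" "clique_free (r + 1) V E"
  shows "\<exists>f. f ` V \<subseteq> {..<r} \<and> card E + card (E - cross_pairs V f) \<le> card (cross_pairs V f)"
  using assms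
proof (induction r arbitrary: V E)
  case 0
  have "V = {}"
  proof (rule ccontr)
    assume "V \<noteq> {}"
    then obtain x where "x \<in> V" by auto
    then have "{x} \<in> [V]\<^bsup>1\<^esup>" "clique {x} E" by (auto simp: nsets_def clique_def)
    with 0(2) show False by (auto simp: clique_free_def)
  qed
  then have "E = {}" using 0(1) by (auto simp: simple_graph_def nsets_def)
  then show ?case using \<open>V = {}\<close> by auto
next
  case (Suc r)
  have finV: "finite V" and EV: "E \<subseteq> [V]\<^bsup>2\<^esup>"
    using Suc.prems(1) by (auto simp: simple_graph_def)
  have finE: "finite E" using finite_subset_nsets_2[OF finV EV] .
  show ?case
  proof (cases "V = {}")
    case True
    then have "E = {}" using EV by (auto simp: nsets_def)
    then show ?thesis using True by auto
  next
    case False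
    then have "Max (degree E ` V) \<in> degree E ` V"
      using finV by (intro Max_in) auto
    then obtain x where "x \<in> V" "Max (degree E ` V) = degree E x" by auto
    then have x: "x \<in> V" "\<And>v. v \<in> V \<Longrightarrow> degree E v \<le> degree E x"
      using finV by (metis Max_ge finite_imageI imageI)+
    define W where "W = {y. {x, y} \<in> E}"
    define U where "U = V - W"
    define E' where "E' = {e \<in> E. e \<subseteq> W}"
    have WV: "W \<subseteq> V" and xW: "x \<notin> W"
      using EV unfolding W_def by (auto simp: nsets_def card_insert_if)
    have finW: "finite W" and finU: "finite U" using WV finV finite_subset by (auto simp: U_def)
    have degx: "degree E x = card W"
      unfolding W_def using degree_eq_card_neighbours[OF EV] .
    have "simple_graph W E'"
      using EV finW by (auto simp: simple_graph_def E'_def nsets_def)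
    moreover have "clique_free (r + 1) W E'"
      unfolding clique_free_def
    proof safe
      fix K assume K: "K \<in> [W]\<^bsup>(r + 1)\<^esup>" and cl: "clique K E'"
      have "insert x K \<in> [V]\<^bsup>(Suc r + 1)\<^esup>"
        using K xW x(1) WV by (auto simp: nsets_def card_insert_if)
      moreover have "clique (insert x K) E"
        using cl K by (auto simp: clique_def E'_def nsets_def W_def insert_commute)
      ultimately show False using Suc.prems(2) by (auto simp: clique_free_def)
    qed
    ultimately obtain f where f: "f ` W \<subseteq> {..<r}"
      "card E' + card (E' - cross_pairs W f) \<le> card (cross_pairs W f)"
      using Suc.IH by blast
    define g where "g = (\<lambda>v. if v \<in> W then f v else r)"
    have gV: "g ` V \<subseteq> {..<Suc r}" using f(1) by (auto simp: g_def less_Suc_eq)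
    let ?C = "cross_pairs V g"
    have finC: "finite ?C" using finite_cross_pairs[OF finV] .
    have classU: "colour_class V g r = U"
      using f(1) by (auto simp: colour_class_def g_def U_def)
    have CW: "{e \<in> ?C. e \<subseteq> W} = cross_pairs W f"
      (is "?L = ?R")
    proof (rule set_eqI)
      fix e
      have "e \<in> ?L \<longleftrightarrow> (\<exists>a b. e = {a, b} \<and> a \<in> W \<and> b \<in> W \<and> g a \<noteq> g b)"
        using WV by (auto simp: cross_pairs_def)
      also have "\<dots> \<longleftrightarrow> e \<in> ?R"
        by (auto simp: cross_pairs_def g_def)
      finally show "e \<in> ?L \<longleftrightarrow> e \<in> ?R" .
    qed
    \<comment> \<open>Every edge meeting \<open>U\<close> is weighted once, and the monochromatic ones once more; the cross
      pairs that meet \<open>U\<close> are weighted exactly once.\<close>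
    have CU: "card (e \<inter> U) = (if e \<subseteq> W then 0 else 1)" if "e \<in> ?C" for e
    proof -
      from that obtain a b where "e = {a, b}" "a \<in> V" "b \<in> V" "g a \<noteq> g b"
        by (auto simp: cross_pairs_def)
      moreover from this have "e \<inter> U = (if e \<subseteq> W then {} else if a \<in> W then {b} else {a})"
        by (auto simp: U_def g_def split: if_splits)
      ultimately show ?thesis by auto
    qed
    have EU: "card (e \<inter> U) = (if e \<subseteq> W then 0 else if e \<in> ?C then 1 else 2)" if eE: "e \<in> E" for e
    proof (cases "e \<in> ?C")
      case True then show ?thesis using CU by auto
    next
      case False
      obtain a b where e: "e = {a, b}" "a \<in> V" "b \<in> V" "a \<noteq> b"
        using eE EV by (rule nsets_2_cases)
      with False have "g a = g b" by (auto simp: pair_in_cross_pairs_iff)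
      with e f(1) have "a \<in> W \<longleftrightarrow> b \<in> W" by (auto simp: g_def split: if_splits)
      with e have "e \<inter> U = (if e \<subseteq> W then {} else {a, b})" by (auto simp: U_def)
      then show ?thesis using False e by auto
    qed
    have "card {e \<in> ?C. \<not> e \<subseteq> W} = (\<Sum>e\<in>?C. if e \<subseteq> W then 0 else 1)"
      using finC by (simp add: sum.If_cases Int_def)
    also have "\<dots> = (\<Sum>e\<in>?C. card (e \<inter> U))"
      by (intro sum.cong) (auto simp: CU)
    also have "\<dots> = (\<Sum>v\<in>U. degree ?C v)"
      using sum_degree[OF finU finC] by simp
    also have "\<dots> = (\<Sum>v\<in>U. card W)"
    proof (rule sum.cong)
      fix v assume v: "v \<in> U"
      then have "degree ?C v + card U = card V"
        using degree_cross_pairs[OF finV, of v g] classU by (auto simp: g_def U_def)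
      moreover have "card U + card W = card V"
        using finV WV finW by (simp add: U_def card_Diff_subset card_mono)
      ultimately show "degree ?C v = card W" by simp
    qed simp
    also have "\<dots> \<ge> (\<Sum>v\<in>U. degree E v)"
      using x(2) degx by (intro sum_mono) (auto simp: U_def)
    also have "(\<Sum>v\<in>U. degree E v) = (\<Sum>e\<in>E. card (e \<inter> U))"
      using sum_degree[OF finU finE] .
    also have "\<dots> = (\<Sum>e\<in>E. (if e \<subseteq> W then 0 else 1) + (if e \<subseteq> W then 0 else if e \<in> ?C then 0 else 1))"
      by (intro sum.cong) (auto simp: EU)
    also have "\<dots> = card {e \<in> E. \<not> e \<subseteq> W} + card {e \<in> E - ?C. \<not> e \<subseteq> W}"
    proof -
      have "{e \<in> E - ?C. \<not> e \<subseteq> W} = {e \<in> E. \<not> e \<subseteq> W \<and> e \<notin> ?C}" by auto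
      moreover have "(\<Sum>e\<in>E. (if e \<subseteq> W then 0 else if e \<in> ?C then 0 else 1::nat))
         = (\<Sum>e\<in>E. if \<not> e \<subseteq> W \<and> e \<notin> ?C then 1 else 0)" by (intro sum.cong) auto
      ultimately show ?thesis
        using finE by (simp add: sum.distrib sum.If_cases Int_def)
    qed
    finally have outer: "card {e \<in> E. \<not> e \<subseteq> W} + card {e \<in> E - ?C. \<not> e \<subseteq> W}
        \<le> card {e \<in> ?C. \<not> e \<subseteq> W}" .
    have split: "card F = card {e \<in> F. e \<subseteq> W} + card {e \<in> F. \<not> e \<subseteq> W}" if "finite F" for F :: "'a set set"
    proof -
      have "F = {e \<in> F. e \<subseteq> W} \<union> {e \<in> F. \<not> e \<subseteq> W}" by auto
      then show ?thesis using that
        by (metis (no_types, lifting) card_Un_disjoint disjoint_iff finite_Un mem_Collect_eq)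
    qed
    have "{e \<in> E - ?C. e \<subseteq> W} = E' - cross_pairs W f"
      using CW by (auto simp: E'_def)
    then have "card E + card (E - ?C) \<le> card ?C"
      using split[OF finE] split[of "E - ?C"] split[OF finC] outer f(2) CW finE
      by (simp add: E'_def)
    then show ?thesis using gV by blast
  qed
qed

section \<open>Transversal cliques\<close>

text \<open>
  Shrink all parts to the size \<open>s\<close> of the smallest one. A fixed missing pair lies in
  \<open>s\<close> to the power \<open>|I| - 2\<close> of the \<open>s\<close> to the power \<open>|I|\<close> transversals. If no transversal is a clique,
  each one contains a missing pair, so there are at least \<open>s\<^sup>2\<close> missing pairs.
\<close>

lemma exists_small_part_if_no_transversal_clique:
  assumes "finite V" "finite I" "I \<noteq> {}"
    and S: "\<And>i. i \<in> I \<Longrightarrow> S i \<subseteq> colour_class V f i"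
    and no_clique: "\<And>K. K \<subseteq> \<Union>(S ` I) \<Longrightarrow> card K = card I \<Longrightarrow> \<not> clique K E"
  shows "\<exists>i\<in>I. (card (S i))\<^sup>2 \<le> card {e \<in> cross_pairs V f - E. e \<subseteq> \<Union>(S ` I)}"
proof (rule ccontr)
  define N where "N = {e \<in> cross_pairs V f - E. e \<subseteq> \<Union>(S ` I)}"
  define s where "s = Min ((\<lambda>i. card (S i)) ` I)"
  assume "\<not> ?thesis"
  then have large: "card N < (card (S i))\<^sup>2" if "i \<in> I" for i
    using that by (auto simp: N_def not_le)
  have "s \<in> (\<lambda>i. card (S i)) ` I" unfolding s_def using assms by (intro Min_in) auto
  with large have sN: "card N < s\<^sup>2" by auto
  then have s0: "s > 0" by (cases s) auto
  have "s \<le> card (S i)" if "i \<in> I" for i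
    unfolding s_def using assms that by (intro Min_le) auto
  then have "\<forall>i\<in>I. \<exists>T. T \<subseteq> S i \<and> card T = s \<and> finite T"
    by (meson obtain_subset_with_card_n)
  then obtain T where T: "\<And>i. i \<in> I \<Longrightarrow> T i \<subseteq> S i \<and> card (T i) = s \<and> finite (T i)"
    by metis
  have fT: "f u = i" if "i \<in> I" "u \<in> S i" for i u
    using S that by (auto simp: colour_class_def)
  have VT: "u \<in> V" if "i \<in> I" "u \<in> S i" for i u
    using S that by (auto simp: colour_class_def)
  have finN: "finite N" unfolding N_def using finite_cross_pairs[OF assms(1)] by auto
  let ?P = "Pi\<^sub>E I T"
  let ?Q = "\<lambda>e. {g \<in> ?P. e \<subseteq> g ` I}"
  have finP: "finite ?P" using assms T by (intro finite_PiE) auto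
  have cardP: "card ?P = s ^ card I"
    using assms T by (simp add: card_PiE)
  have cover: "?P \<subseteq> (\<Union>e\<in>N. ?Q e)"
  proof
    fix g assume g: "g \<in> ?P"
    have gS: "g i \<in> S i" if "i \<in> I" for i using g T that by blast
    have "inj_on g I" using gS fT by (metis inj_onI)
    then have "card (g ` I) = card I" by (rule card_image)
    moreover have "g ` I \<subseteq> \<Union>(S ` I)" using gS by auto
    ultimately have "\<not> clique (g ` I) E" by (rule no_clique[rotated])
    then obtain i j where ij: "i \<in> I" "j \<in> I" "g i \<noteq> g j" "{g i, g j} \<notin> E"
      by (auto simp: clique_def)
    then have "f (g i) \<noteq> f (g j)" using fT gS by metis
    then have "{g i, g j} \<in> N"
      using ij gS VT by (auto simp: N_def pair_in_cross_pairs_iff)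
    with g ij show "g \<in> (\<Union>e\<in>N. ?Q e)" by (intro UN_I[of "{g i, g j}"]) auto
  qed
  have few: "card (?Q e) * s\<^sup>2 \<le> s ^ card I" if "e \<in> N" for e
  proof -
    have eC: "e \<in> cross_pairs V f" "e \<subseteq> \<Union>(S ` I)" using that by (auto simp: N_def)
    then obtain u v where e: "e = {u, v}" "f u \<noteq> f v" by (auto simp: cross_pairs_def)
    with eC fT have I: "f u \<in> I" "f v \<in> I" by auto
    \<comment> \<open>A transversal through \<open>u\<close> and \<open>v\<close> is free only at the other colours.\<close>
    let ?R = "\<lambda>k. if k = f u then {u} else if k = f v then {v} else T k"
    have "?Q e \<subseteq> Pi\<^sub>E I ?R"
    proof
      fix g assume g: "g \<in> ?Q e"
      have gfix: "g (f w) = w" if w: "w \<in> {u, v}" for w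
      proof -
        have "w \<in> g ` I" using g e w by auto
        then obtain i where i: "i \<in> I" "w = g i" by auto
        then have "w \<in> S i" using g T by blast
        then show ?thesis using i fT by metis
      qed
      with g show "g \<in> Pi\<^sub>E I ?R" by (auto simp: PiE_iff)
    qed
    moreover have "finite (Pi\<^sub>E I ?R)" using assms T by (intro finite_PiE) auto
    ultimately have "card (?Q e) \<le> card (Pi\<^sub>E I ?R)" by (rule card_mono[rotated])
    also have "\<dots> = (\<Prod>k\<in>I. card (?R k))" using assms by (simp add: card_PiE)
    also have "\<dots> = (\<Prod>k\<in>I - {f u, f v}. card (?R k))"
      using assms by (intro prod.mono_neutral_right) auto
    also have "\<dots> = (\<Prod>k\<in>I - {f u, f v}. s)"
      using T by (intro prod.cong) auto
    also have "\<dots> = s ^ (card I - 2)"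
      using e I assms by (simp add: card_Diff_subset numeral_2_eq_2)
    finally have "card (?Q e) * s\<^sup>2 \<le> s ^ (card I - 2) * s\<^sup>2" by (rule mult_right_mono) simp
    moreover have "card {f u, f v} \<le> card I" using I assms by (intro card_mono) auto
    then have "2 \<le> card I" using e(2) by simp
    then have "s ^ (card I - 2) * s\<^sup>2 = s ^ card I"
      by (metis le_add_diff_inverse2 power_add)
    ultimately show ?thesis by simp
  qed
  have "s ^ card I \<le> card (\<Union>e\<in>N. ?Q e)"
    unfolding cardP[symmetric] using cover finN finP by (intro card_mono) auto
  also have "\<dots> \<le> (\<Sum>e\<in>N. card (?Q e))" by (rule card_UN_le[OF finN])
  finally have "s ^ card I * s\<^sup>2 \<le> (\<Sum>e\<in>N. card (?Q e)) * s\<^sup>2"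
    by (rule mult_right_mono) simp
  also have "\<dots> = (\<Sum>e\<in>N. card (?Q e) * s\<^sup>2)" by (rule sum_distrib_right)
  also have "\<dots> \<le> (\<Sum>e\<in>N. s ^ card I)" by (intro sum_mono few)
  also have "\<dots> < s ^ card I * s\<^sup>2" using sN s0 by simp
  finally show False by simp
qed

section \<open>Optimal and balanced colourings\<close>

text \<open>
  Otherwise recolouring \<open>x\<close> with \<open>j\<close> would decrease the number of monochromatic edges.
\<close>

lemma monochromatic_degree_le_if_optimal:
  assumes "finite V" "E \<subseteq> [V]\<^bsup>2\<^esup>" "f ` V \<subseteq> {..<r}"
    and opt: "\<And>g. g ` V \<subseteq> {..<r} \<Longrightarrow> card (E - cross_pairs V f) \<le> card (E - cross_pairs V g)"
    and "j < r"
  shows "degree (E - cross_pairs V f) x \<le> card {y \<in> colour_class V f j. {x, y} \<in> E}"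
proof -
  let ?B = "E - cross_pairs V f"
  let ?Y = "{y \<in> colour_class V f j. {x, y} \<in> E}"
  define g where "g = f(x := j)"
  have finE: "finite E" using finite_subset_nsets_2[OF assms(1,2)] .
  have finY: "finite ?Y" using assms(1) by (simp add: colour_class_def)
  have "E - cross_pairs V g \<subseteq> {e \<in> ?B. x \<notin> e} \<union> (\<lambda>y. {x, y}) ` ?Y"
  proof
    fix e assume e: "e \<in> E - cross_pairs V g"
    then obtain a b where ab: "e = {a, b}" "a \<in> V" "b \<in> V" "a \<noteq> b"
      using assms(2) by (metis DiffD1 nsets_2_cases)
    with e have gab: "g a = g b" by (auto simp: pair_in_cross_pairs_iff)
    consider "x \<notin> e" | "a = x" | "b = x" using ab by auto
    then show "e \<in> {e \<in> ?B. x \<notin> e} \<union> (\<lambda>y. {x, y}) ` ?Y"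
    proof cases
      case 1
      with ab gab have "f a = f b" by (auto simp: g_def)
      with 1 ab e show ?thesis by (auto simp: pair_in_cross_pairs_iff)
    next
      case 2
      with ab gab e have "b \<in> ?Y" by (auto simp: g_def colour_class_def)
      with 2 ab show ?thesis by auto
    next
      case 3
      with ab gab e have "a \<in> ?Y" by (auto simp: g_def colour_class_def insert_commute)
      with 3 ab show ?thesis by (auto simp: insert_commute)
    qed
  qed
  then have "card (E - cross_pairs V g) \<le> card ({e \<in> ?B. x \<notin> e} \<union> (\<lambda>y. {x, y}) ` ?Y)"
    using finE finY by (intro card_mono) auto
  also have "\<dots> \<le> card {e \<in> ?B. x \<notin> e} + card ((\<lambda>y. {x, y}) ` ?Y)"
    by (rule card_Un_le)
  also have "card ((\<lambda>y. {x, y}) ` ?Y) \<le> card ?Y"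
    using finY by (rule card_image_le)
  finally have "card (E - cross_pairs V g) \<le> card {e \<in> ?B. x \<notin> e} + card ?Y" by simp
  moreover have "card ?B \<le> card (E - cross_pairs V g)"
    using assms(3,5) by (intro opt) (auto simp: g_def)
  moreover have "card ?B = degree ?B x + card {e \<in> ?B. x \<notin> e}"
  proof -
    have "card ({e \<in> ?B. x \<in> e} \<union> {e \<in> ?B. x \<notin> e}) = card {e \<in> ?B. x \<in> e} + card {e \<in> ?B. x \<notin> e}"
      using finE by (intro card_Un_disjoint) auto
    moreover have "{e \<in> ?B. x \<in> e} \<union> {e \<in> ?B. x \<notin> e} = ?B" by auto
    ultimately show ?thesis unfolding degree_def by simp
  qed
  ultimately show ?thesis by linarith
qed

text \<open>
  The nonempty colour classes form the required partition, which may have fewer than \<open>r\<close> blocks.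
\<close>

lemma partite_distance_le_card_monochromatic:
  assumes "simple_graph V E" "f ` V \<subseteq> {..<r}"
  shows "partite_distance r V E \<le> card (E - cross_pairs V f)"
proof -
  have finE: "finite E" using simple_graph_finite_edges[OF assms(1)] .
  let ?P = "colour_class V f ` (f ` V)"
  have "partition_on V ?P"
    by (auto simp: partition_on_def disjoint_def colour_class_def)
  moreover have "card ?P \<le> r"
    using card_image_le[of "f ` V" "colour_class V f"] assms(2)
    by (metis card_lessThan card_mono finite_lessThan finite_subset le_trans)
  moreover have "indep X (E - (E - cross_pairs V f))" if "X \<in> ?P" for X
    using that by (auto simp: indep_def colour_class_def pair_in_cross_pairs_iff)
  ultimately have "r_partite r V (E - (E - cross_pairs V f))"
    unfolding r_partite_def by blast
  then have "card (E - cross_pairs V f) \<in> {card F | F. F \<subseteq> E \<and> r_partite r V (E - F)}"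
    by (intro CollectI exI[of _ "E - cross_pairs V f"]) auto
  moreover have "finite {card F | F. F \<subseteq> E \<and> r_partite r V (E - F)}"
    by (rule finite_subset[of _ "{..card E}"]) (auto intro: card_mono finE)
  ultimately show ?thesis
    unfolding partite_distance_def by (intro Min_le)
qed

text \<open>
  Add the vertices one by one, each to a smallest class.
\<close>

lemma exists_balanced_colouring:
  assumes "finite V" "r \<ge> 1"
  shows "\<exists>f. f ` V \<subseteq> {..<r}
     \<and> (\<forall>i<r. \<forall>j<r. card (colour_class V f i) \<le> card (colour_class V f j) + 1)"
  using assms(1)
proof (induction V)
  case empty
  then show ?case by (simp add: colour_class_def)
next
  case (insert x V)
  from insert.IH obtain f where f: "f ` V \<subseteq> {..<r}"
    "\<forall>i<r. \<forall>j<r. card (colour_class V f i) \<le> card (colour_class V f j) + 1"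
    by (elim exE conjE)
  obtain k where k: "k < r" "\<And>j. j < r \<Longrightarrow> card (colour_class V f k) \<le> card (colour_class V f j)"
    using ex_has_least_nat[of "\<lambda>k. k < r" 0 "\<lambda>k. card (colour_class V f k)"] assms(2) by auto
  have "colour_class (insert x V) (f(x := k)) i
      = (if i = k then insert x (colour_class V f i) else colour_class V f i)" for i
    using insert.hyps by (auto simp: colour_class_def)
  moreover have "finite (colour_class V f i)" "x \<notin> colour_class V f i" for i
    using insert.hyps by (auto simp: colour_class_def)
  ultimately have "card (colour_class (insert x V) (f(x := k)) i)
      = card (colour_class V f i) + (if i = k then 1 else 0)" for i
    by simp
  then have "\<forall>i<r. \<forall>j<r. card (colour_class (insert x V) (f(x := k)) i)
      \<le> card (colour_class (insert x V) (f(x := k)) j) + 1"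
    using f(2) k by (auto intro: le_SucI)
  moreover have "(f(x := k)) ` insert x V \<subseteq> {..<r}" using f(1) k(1) by auto
  ultimately show ?case by blast
qed

text \<open>
  The number of crossing pairs is determined by the variance of the class sizes: it is large exactly
  when the classes are balanced.
\<close>

lemma sum_squared_deviations_colour_classes:
  assumes "finite V" "f ` V \<subseteq> {..<r}" "r \<ge> 1"
  shows "(\<Sum>i<r. (real (card (colour_class V f i)) - real (card V) / real r)\<^sup>2)
     = (real (card V))\<^sup>2 - (real (card V))\<^sup>2 / real r - 2 * real (card (cross_pairs V f))"
proof -
  let ?c = "\<lambda>i. real (card (colour_class V f i))"
  let ?a = "real (card V) / real r"
  have 1: "(\<Sum>i<r. ?c i) = real (card V)"
    using sum_card_colour_classes[OF assms(1,2)] by (simp flip: of_nat_sum)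
  have 2: "2 * real (card (cross_pairs V f)) + (\<Sum>i<r. (?c i)\<^sup>2) = (real (card V))\<^sup>2"
    using arg_cong[OF card_cross_pairs[OF assms(1,2)], of real] by simp
  have "(\<Sum>i<r. (?c i - ?a)\<^sup>2) = (\<Sum>i<r. (?c i)\<^sup>2 - 2 * ?a * ?c i + ?a\<^sup>2)"
    by (intro sum.cong) (simp_all add: power2_diff)
  also have "\<dots> = (\<Sum>i<r. (?c i)\<^sup>2) - 2 * ?a * (\<Sum>i<r. ?c i) + real r * ?a\<^sup>2"
    by (simp add: sum.distrib sum_subtractf sum_distrib_left)
  also have "\<dots> = (\<Sum>i<r. (?c i)\<^sup>2) - (real (card V))\<^sup>2 / real r"
    unfolding 1 using assms(3) by (simp add: power2_eq_square field_simps)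
  finally show ?thesis using 2 by linarith
qed

text \<open>
  In a balanced colouring every class size is within \<open>1\<close> of the average, so the sum of the
  squared deviations is at most \<open>r\<close>. This is weaker than the exact Turan number, but the loss
  is absorbed into \<open>r t\<close> once \<open>t \<ge> 1\<close>.
\<close>

lemma turan_number_lower_bound:
  assumes "r \<ge> 1"
  shows "(real n)\<^sup>2 - (real n)\<^sup>2 / real r - real r \<le> 2 * real (turan_number n (r + 1))"
proof -
  obtain g where g: "g ` {..<n} \<subseteq> {..<r}"
    "\<forall>i<r. \<forall>j<r. card (colour_class {..<n} g i) \<le> card (colour_class {..<n} g j) + 1"
    using exists_balanced_colouring[OF finite_lessThan assms, of n] by (elim exE conjE)
  let ?c = "\<lambda>i. real (card (colour_class {..<n} g i))"
  have bal: "?c i \<le> ?c j + 1" if "i < r" "j < r" for i j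
    using g(2) that by fastforce
  have total: "(\<Sum>i<r. ?c i) = real n"
    using sum_card_colour_classes[of "{..<n}" g r] g(1) by (simp flip: of_nat_sum)
  have "(?c i - real n / real r)\<^sup>2 \<le> 1" if i: "i < r" for i
  proof -
    have "(\<Sum>j<r. ?c i) \<le> (\<Sum>j<r. ?c j + 1)" by (intro sum_mono) (use bal i in auto)
    then have "real r * ?c i \<le> real n + real r" using total by (simp add: sum.distrib)
    moreover have "(\<Sum>j<r. ?c j) \<le> (\<Sum>j<r. ?c i + 1)" by (intro sum_mono) (use bal i in auto)
    then have "real n \<le> real r * (?c i + 1)" using total by simp
    ultimately have "\<bar>?c i - real n / real r\<bar> \<le> 1"
      using assms by (simp add: abs_le_iff field_simps)
    then show ?thesis by (simp add: abs_square_le_1)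
  qed
  then have "(\<Sum>i<r. (?c i - real n / real r)\<^sup>2) \<le> (\<Sum>i<r. 1)"
    by (intro sum_mono) auto
  then have "(real n)\<^sup>2 - (real n)\<^sup>2 / real r - 2 * real (card (cross_pairs {..<n} g)) \<le> real r"
    using sum_squared_deviations_colour_classes[of "{..<n}" g r] g(1) assms by simp
  moreover have "card (cross_pairs {..<n} g) \<le> turan_number n (r + 1)"
    using card_cross_pairs_le_turan_number[of "{..<n}" g r] g(1) by simp
  ultimately show ?thesis by linarith
qed

lemma colour_class_near_average:
  assumes "finite V" "f ` V \<subseteq> {..<r}" "i < r"
    and "real (turan_number (card V) (r + 1)) - d \<le> real (card (cross_pairs V f))"
  shows "(real (card (colour_class V f i)) - real (card V) / real r)\<^sup>2 \<le> 2 * d + real r"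
proof -
  let ?dev = "\<lambda>i. (real (card (colour_class V f i)) - real (card V) / real r)\<^sup>2"
  have "?dev i \<le> (\<Sum>i<r. ?dev i)"
    using assms(3) by (intro member_le_sum) auto
  then show ?thesis
    using sum_squared_deviations_colour_classes[OF assms(1,2)]
      turan_number_lower_bound[of r "card V"] assms(3,4) by simp
qed

section \<open>Missing pairs in an optimal colouring\<close>

text \<open>
  The common neighbours of \<open>x\<close> and \<open>y\<close> in the \<open>r - 1\<close> other classes span no transversal clique, as
  it would extend to a clique of size \<open>r + 1\<close>. So in one of these classes there are at most \<open>sqrt |M|\<close> common
  neighbours, and all other vertices of that class are missed by \<open>x\<close> or by \<open>y\<close>.
\<close>

lemma monochromatic_edge_forces_missing_pairs:
  assumes "simple_graph V E" "clique_free (r + 1) V E" "f ` V \<subseteq> {..<r}" "r \<ge> 2"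
    and xy: "{x, y} \<in> E - cross_pairs V f"
  shows "\<exists>j<r. real (card (colour_class V f j)) \<le> sqrt (card (cross_pairs V f - E))
      + real (degree (cross_pairs V f - E) x) + real (degree (cross_pairs V f - E) y)"
proof -
  let ?M = "cross_pairs V f - E"
  have finV: "finite V" and EV: "E \<subseteq> [V]\<^bsup>2\<^esup>"
    using assms(1) by (auto simp: simple_graph_def)
  have "{x, y} \<in> [V]\<^bsup>2\<^esup>" using xy EV by blast
  then have xV: "x \<in> V" "y \<in> V" "x \<noteq> y" by auto
  then have fxy: "f x = f y" using xy by (auto simp: pair_in_cross_pairs_iff)
  have MV: "?M \<subseteq> [V]\<^bsup>2\<^esup>" using cross_pairs_subset by blast
  have finM: "finite ?M" using finite_cross_pairs[OF finV] by auto
  define I where "I = {..<r} - {f x}"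
  define S where "S = (\<lambda>i. {v \<in> colour_class V f i. {x, v} \<in> E \<and> {y, v} \<in> E})"
  have fxr: "f x < r" using assms(3) xV by auto
  have cardI: "card I = r - 1" using fxr by (simp add: I_def)
  have "\<exists>i\<in>I. (card (S i))\<^sup>2 \<le> card {e \<in> ?M. e \<subseteq> \<Union>(S ` I)}"
  proof (rule exists_small_part_if_no_transversal_clique[OF finV])
    show "finite I" by (simp add: I_def)
    show "I \<noteq> {}" using cardI assms(4) by auto
    show "S i \<subseteq> colour_class V f i" for i by (auto simp: S_def)
    fix K assume K: "K \<subseteq> \<Union>(S ` I)" "card K = card I"
    show "\<not> clique K E"
    proof
      assume cl: "clique K E"
      have KV: "K \<subseteq> V" using K by (auto simp: S_def colour_class_def)
      have xK: "x \<notin> K" "y \<notin> K" using K fxy by (auto simp: S_def I_def colour_class_def)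
      have "finite K" using KV finV finite_subset by blast
      then have "insert x (insert y K) \<in> [V]\<^bsup>(r + 1)\<^esup>"
        using KV xV xK K(2) cardI assms(4) by (simp add: nsets_def)
      moreover have "{x, v} \<in> E \<and> {y, v} \<in> E" if "v \<in> K" for v
        using K that by (auto simp: S_def)
      then have "clique (insert x (insert y K)) E"
        using cl xy by (auto simp: clique_def insert_commute)
      ultimately show False using assms(2) by (auto simp: clique_free_def)
    qed
  qed
  then obtain j where j: "j \<in> I" "(card (S j))\<^sup>2 \<le> card {e \<in> ?M. e \<subseteq> \<Union>(S ` I)}" by blast
  note j(2)
  also have "\<dots> \<le> card ?M" using finM by (intro card_mono) auto
  finally have "(real (card (S j)))\<^sup>2 \<le> real (card ?M)"
    by (metis of_nat_le_iff of_nat_power)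
  then have Sj: "real (card (S j)) \<le> sqrt (card ?M)" by (rule real_le_rsqrt)
  have nbrs: "finite {v. {z, v} \<in> ?M}" for z
    by (rule finite_subset[OF _ finV]) (auto simp: pair_in_cross_pairs_iff)
  have "colour_class V f j \<subseteq> S j \<union> {v. {x, v} \<in> ?M} \<union> {v. {y, v} \<in> ?M}"
    using j(1) xV fxy by (auto simp: colour_class_def S_def I_def pair_in_cross_pairs_iff)
  then have "card (colour_class V f j) \<le> card (S j \<union> {v. {x, v} \<in> ?M} \<union> {v. {y, v} \<in> ?M})"
    using nbrs finV by (intro card_mono) (auto simp: S_def colour_class_def)
  also have "\<dots> \<le> card (S j) + card {v. {x, v} \<in> ?M} + card {v. {y, v} \<in> ?M}"
    by (meson add_le_mono card_Un_le le_refl order_trans)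
  also have "\<dots> = card (S j) + degree ?M x + degree ?M y"
    by (simp only: degree_eq_card_neighbours[OF MV])
  finally have "real (card (colour_class V f j))
      \<le> real (card (S j)) + real (degree ?M x) + real (degree ?M y)" by linarith
  then show ?thesis using Sj j(1) by (intro exI[of _ j]) (auto simp: I_def)
qed

text \<open>
  The source of the term \<open>w\<^sup>2\<close> in the optimisation. In every class, its own included, \<open>x\<close> has at least as
  many neighbours as its monochromatic degree, by optimality. They span no transversal clique, even
  after the vertices of \<open>X\<close> are discarded. Discarding \<open>X\<close> makes the missing pairs found here
  disjoint from those that are counted at the vertices of \<open>X\<close>.
\<close>

lemma monochromatic_degree_forces_missing_pairs:
  assumes "simple_graph V E" "clique_free (r + 1) V E" "f ` V \<subseteq> {..<r}" "r \<ge> 1"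
    and opt: "\<And>g. g ` V \<subseteq> {..<r} \<Longrightarrow> card (E - cross_pairs V f) \<le> card (E - cross_pairs V g)"
    and "x \<in> V" "finite X"
  shows "real (degree (E - cross_pairs V f) x)
      \<le> real (card X) + sqrt (card {e \<in> cross_pairs V f - E. e \<inter> X = {}})"
proof -
  let ?M = "cross_pairs V f - E"
  have finV: "finite V" and EV: "E \<subseteq> [V]\<^bsup>2\<^esup>"
    using assms(1) by (auto simp: simple_graph_def)
  have finM: "finite ?M" using finite_cross_pairs[OF finV] by auto
  let ?N = "\<lambda>i. {v \<in> colour_class V f i. {x, v} \<in> E}"
  define S where "S = (\<lambda>i. ?N i - X)"
  have "\<exists>i\<in>{..<r}. (card (S i))\<^sup>2 \<le> card {e \<in> ?M. e \<subseteq> \<Union>(S ` {..<r})}"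
  proof (rule exists_small_part_if_no_transversal_clique[OF finV])
    show "{..<r} \<noteq> {}" using assms(4) by (simp add: lessThan_empty_iff)
    show "S i \<subseteq> colour_class V f i" for i by (auto simp: S_def)
    fix K assume K: "K \<subseteq> \<Union>(S ` {..<r})" "card K = card {..<r}"
    show "\<not> clique K E"
    proof
      assume cl: "clique K E"
      have KV: "K \<subseteq> V" using K by (auto simp: S_def colour_class_def)
      have xE: "{x, v} \<in> E" if "v \<in> K" for v using K that by (auto simp: S_def)
      have "x \<notin> K"
      proof
        assume "x \<in> K"
        then have "{x, x} \<in> [V]\<^bsup>2\<^esup>" using xE EV by blast
        then show False by (simp only: doubleton_in_nsets_2) simp
      qed
      moreover have "finite K" using KV finV finite_subset by blast
      ultimately have "insert x K \<in> [V]\<^bsup>(r + 1)\<^esup>"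
        using KV assms(6) K(2) by (simp add: nsets_def)
      moreover have "clique (insert x K) E"
        using cl xE by (auto simp: clique_def insert_commute)
      ultimately show False using assms(2) by (auto simp: clique_free_def)
    qed
  qed simp
  then obtain j where j: "j < r" "(card (S j))\<^sup>2 \<le> card {e \<in> ?M. e \<subseteq> \<Union>(S ` {..<r})}" by auto
  note j(2)
  also have "\<dots> \<le> card {e \<in> ?M. e \<inter> X = {}}"
    using finite_cross_pairs[OF finV] by (intro card_mono) (auto simp: S_def)
  finally have "(real (card (S j)))\<^sup>2 \<le> real (card {e \<in> ?M. e \<inter> X = {}})"
    by (metis of_nat_le_iff of_nat_power)
  then have Sj: "real (card (S j)) \<le> sqrt (card {e \<in> ?M. e \<inter> X = {}})" by (rule real_le_rsqrt)
  have "degree (E - cross_pairs V f) x \<le> card (?N j)"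
    using monochromatic_degree_le_if_optimal[OF finV EV assms(3) opt j(1)] .
  also have "\<dots> \<le> card (S j \<union> X)"
    using finV assms(7) by (intro card_mono) (auto simp: S_def colour_class_def)
  also have "\<dots> \<le> card (S j) + card X" by (rule card_Un_le)
  finally show ?thesis using Sj by linarith
qed

lemma card_edges_inside_le:
  assumes "F \<subseteq> [V]\<^bsup>2\<^esup>" "finite X"
  shows "real (card {e \<in> F. e \<subseteq> X}) \<le> (real (card X))\<^sup>2 / 2"
proof -
  have "card {e \<in> F. e \<subseteq> X} \<le> card ([X]\<^bsup>2\<^esup>)"
    using assms by (intro card_mono finite_imp_finite_nsets) (auto simp: nsets_def)
  also have "\<dots> = card X choose 2" by simp
  finally have "2 * card {e \<in> F. e \<subseteq> X} \<le> card X * (card X - 1)"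
    by (simp add: choose_two)
  also have "\<dots> \<le> (card X)\<^sup>2" by (simp add: power2_eq_square)
  finally have "real (2 * card {e \<in> F. e \<subseteq> X}) \<le> real ((card X)\<^sup>2)"
    by (simp only: of_nat_le_iff)
  then show ?thesis by simp
qed

text \<open>
  A degree sum over \<open>X\<close> counts twice only the edges inside \<open>X\<close>.
\<close>

lemma card_edges_meeting_ge:
  assumes "finite V" "F \<subseteq> [V]\<^bsup>2\<^esup>" "X \<subseteq> V"
  shows "real (\<Sum>x\<in>X. degree F x) - (real (card X))\<^sup>2 / 2 \<le> real (card {e \<in> F. e \<inter> X \<noteq> {}})"
proof -
  have finX: "finite X" and finF: "finite F"
    using finite_subset[OF assms(3,1)] finite_subset_nsets_2[OF assms(1,2)] .
  have "card (e \<inter> X) \<le> (if e \<inter> X \<noteq> {} then 1 else 0) + (if e \<subseteq> X then 1 else 0)" if eF: "e \<in> F" for e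
  proof -
    obtain a b where "e = {a, b}" using eF assms(2) by (rule nsets_2_cases)
    then show ?thesis by (auto simp: Int_insert_left card_insert_if)
  qed
  then have "(\<Sum>e\<in>F. card (e \<inter> X))
      \<le> (\<Sum>e\<in>F. (if e \<inter> X \<noteq> {} then 1 else 0) + (if e \<subseteq> X then 1 else 0))"
    by (rule sum_mono)
  also have "\<dots> = card {e \<in> F. e \<inter> X \<noteq> {}} + card {e \<in> F. e \<subseteq> X}"
  proof -
    have "(\<Sum>e\<in>F. if P e then 1 else 0) = card {e \<in> F. P e}" for P
      using finF by (simp add: sum.If_cases Int_def)
    then show ?thesis by (simp only: sum.distrib)
  qed
  finally have "(\<Sum>x\<in>X. degree F x) \<le> card {e \<in> F. e \<inter> X \<noteq> {}} + card {e \<in> F. e \<subseteq> X}"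
    using sum_degree[OF finX finF] by simp
  then have "real (\<Sum>x\<in>X. degree F x) \<le> real (card {e \<in> F. e \<inter> X \<noteq> {}}) + real (card {e \<in> F. e \<subseteq> X})"
    by linarith
  then show ?thesis using card_edges_inside_le[OF assms(2) finX] by linarith
qed

text \<open>
  Here \<open>h\<close> is the threshold above which a vertex is bad and \<open>L\<close> is a lower bound for the class sizes.
  The witnesses are the number \<open>p\<close> of bad vertices, the number \<open>k\<close> of bad vertices with a
  monochromatic edge to a good one, and the square root \<open>w\<close> of the number of missing pairs
  without a bad vertex. The gap assumption excludes monochromatic edges between good vertices,
  so that every monochromatic edge lies inside the bad set or meets one of those \<open>k\<close> vertices.
\<close>

lemma optimal_colouring_inequalities:
  fixes h L :: real
  assumes G: "simple_graph V E" "clique_free (r + 1) V E" and f: "f ` V \<subseteq> {..<r}" and r: "r \<ge> 2"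
    and opt: "\<And>g. g ` V \<subseteq> {..<r} \<Longrightarrow> card (E - cross_pairs V f) \<le> card (E - cross_pairs V g)"
    and L: "\<And>j. j < r \<Longrightarrow> L \<le> real (card (colour_class V f j))"
    and hL: "sqrt (card (cross_pairs V f - E)) + 2 * h < L"
  shows "\<exists>p k w. 0 \<le> k \<and> k \<le> p \<and> 0 \<le> w
     \<and> p * h \<le> 2 * real (card (cross_pairs V f - E))
     \<and> real (card (E - cross_pairs V f)) \<le> p\<^sup>2 / 2 + k * (p + w)
     \<and> k * (L - sqrt (card (cross_pairs V f - E)) - h) - k\<^sup>2 / 2 + w\<^sup>2
         \<le> real (card (cross_pairs V f - E))"
proof -
  let ?M = "cross_pairs V f - E" and ?B = "E - cross_pairs V f"
  have finV: "finite V" and EV: "E \<subseteq> [V]\<^bsup>2\<^esup>"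
    using G(1) by (auto simp: simple_graph_def)
  have MV: "?M \<subseteq> [V]\<^bsup>2\<^esup>" using cross_pairs_subset by blast
  have BV: "?B \<subseteq> [V]\<^bsup>2\<^esup>" using EV by blast
  have finC: "finite (cross_pairs V f)" and finE: "finite E"
    using finite_subset_nsets_2[OF finV] EV finite_cross_pairs[OF finV] by blast+
  \<comment> \<open>\<open>X\<close> is the set of bad vertices; \<open>Y\<close> consists of those with a monochromatic edge to a good one.\<close>
  define X where "X = {x \<in> V. h < real (degree ?M x)}"
  define Y where "Y = {x \<in> X. \<exists>y\<in>V - X. {x, y} \<in> ?B}"
  have XV: "X \<subseteq> V" and YX: "Y \<subseteq> X" by (auto simp: X_def Y_def)
  have YV: "Y \<subseteq> V" using XV YX by (rule order_trans[rotated])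
  have finX: "finite X" and finY: "finite Y"
    using finite_subset[OF XV finV] finite_subset[OF YV finV] .
  define w where "w = sqrt (card {e \<in> ?M. e \<inter> X = {}})"
  have few: "real (card X) * h \<le> 2 * real (card ?M)"
  proof -
    have "real (card X) * h = (\<Sum>x\<in>X. h)" by simp
    also have "\<dots> \<le> (\<Sum>x\<in>X. real (degree ?M x))" by (intro sum_mono) (auto simp: X_def)
    also have "\<dots> \<le> (\<Sum>x\<in>V. real (degree ?M x))"
      using XV finV by (intro sum_mono2) auto
    also have "\<dots> = 2 * real (card ?M)"
      using arg_cong[OF handshake[OF finV MV], of real] by simp
    finally show ?thesis .
  qed
  have missing: "L - sqrt (card ?M) \<le> real (degree ?M x) + real (degree ?M y)" if "{x, y} \<in> ?B" for x y
  proof -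
    obtain j where "j < r" "real (card (colour_class V f j))
        \<le> sqrt (card ?M) + real (degree ?M x) + real (degree ?M y)"
      using monochromatic_edge_forces_missing_pairs[OF G f r \<open>{x, y} \<in> ?B\<close>] by blast
    with L[of j] show ?thesis by linarith
  qed
  have cover: "?B \<subseteq> {e \<in> ?B. e \<subseteq> X} \<union> (\<Union>x\<in>Y. {e \<in> ?B. x \<in> e})"
  proof
    fix e assume e: "e \<in> ?B"
    then obtain x y where xy: "e = {x, y}" "x \<in> V" "y \<in> V" using BV by (rule nsets_2_cases)
    have B: "{x, y} \<in> ?B" "{y, x} \<in> ?B" using e xy(1) by (simp_all add: insert_commute)
    have "x \<in> X \<or> y \<in> X"
      using missing[OF B(1)] xy hL by (auto simp: X_def)
    moreover have "x \<in> Y" if "x \<in> X" "y \<notin> X" using that xy B(1) unfolding Y_def by blast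
    moreover have "y \<in> Y" if "y \<in> X" "x \<notin> X" using that xy B(2) unfolding Y_def by blast
    ultimately have "e \<subseteq> X \<or> x \<in> Y \<or> y \<in> Y" using xy(1) by blast
    then consider "e \<subseteq> X" | "x \<in> Y" | "y \<in> Y" by blast
    then show "e \<in> {e \<in> ?B. e \<subseteq> X} \<union> (\<Union>x\<in>Y. {e \<in> ?B. x \<in> e})"
      using e xy by cases auto
  qed
  have "card ?B \<le> card ({e \<in> ?B. e \<subseteq> X} \<union> (\<Union>x\<in>Y. {e \<in> ?B. x \<in> e}))"
    using finE finY by (intro card_mono[OF _ cover]) auto
  also have "\<dots> \<le> card {e \<in> ?B. e \<subseteq> X} + card (\<Union>x\<in>Y. {e \<in> ?B. x \<in> e})"
    by (rule card_Un_le)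
  also have "card (\<Union>x\<in>Y. {e \<in> ?B. x \<in> e}) \<le> (\<Sum>x\<in>Y. degree ?B x)"
    unfolding degree_def by (rule card_UN_le[OF finY])
  finally have "real (card ?B) \<le> real (card {e \<in> ?B. e \<subseteq> X}) + (\<Sum>x\<in>Y. real (degree ?B x))"
    by (simp flip: of_nat_sum of_nat_add)
  also have "real (card {e \<in> ?B. e \<subseteq> X}) \<le> (real (card X))\<^sup>2 / 2"
    by (rule card_edges_inside_le[OF BV finX])
  also have "(\<Sum>x\<in>Y. real (degree ?B x)) \<le> (\<Sum>x\<in>Y. real (card X) + w)"
    unfolding w_def using r YV
    by (intro sum_mono monochromatic_degree_forces_missing_pairs[OF G f _ opt _ finX]) auto
  finally have bad: "real (card ?B) \<le> (real (card X))\<^sup>2 / 2 + real (card Y) * (real (card X) + w)"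
    by simp
  have "real (card Y) * (L - sqrt (card ?M) - h) = (\<Sum>x\<in>Y. L - sqrt (card ?M) - h)" by simp
  also have "\<dots> \<le> (\<Sum>x\<in>Y. real (degree ?M x))"
  proof (rule sum_mono)
    fix x assume "x \<in> Y"
    then obtain y where "y \<in> V" "y \<notin> X" "{x, y} \<in> ?B" by (auto simp: Y_def)
    then show "L - sqrt (card ?M) - h \<le> real (degree ?M x)"
      using missing[of x y] by (auto simp: X_def)
  qed
  also have "\<dots> - (real (card Y))\<^sup>2 / 2 \<le> real (card {e \<in> ?M. e \<inter> Y \<noteq> {}})"
    using card_edges_meeting_ge[OF finV MV YV] by simp
  finally have "real (card Y) * (L - sqrt (card ?M) - h) - (real (card Y))\<^sup>2 / 2
      \<le> real (card {e \<in> ?M. e \<inter> Y \<noteq> {}})" by simp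
  moreover have "card {e \<in> ?M. e \<inter> Y \<noteq> {}} + card {e \<in> ?M. e \<inter> X = {}} \<le> card ?M"
  proof -
    have "card {e \<in> ?M. e \<inter> Y \<noteq> {}} + card {e \<in> ?M. e \<inter> X = {}}
        = card ({e \<in> ?M. e \<inter> Y \<noteq> {}} \<union> {e \<in> ?M. e \<inter> X = {}})"
      using finC YX by (intro card_Un_disjoint[symmetric]) auto
    also have "\<dots> \<le> card ?M" using finC by (intro card_mono) auto
    finally show ?thesis .
  qed
  then have "real (card {e \<in> ?M. e \<inter> Y \<noteq> {}}) + w\<^sup>2 \<le> real (card ?M)"
    by (simp add: w_def flip: of_nat_add)
  ultimately have "real (card Y) * (L - sqrt (card ?M) - h) - (real (card Y))\<^sup>2 / 2 + w\<^sup>2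
      \<le> real (card ?M)" by linarith
  moreover have "card Y \<le> card X" using YX finX by (rule card_mono[rotated])
  moreover have "0 \<le> w" by (simp add: w_def)
  ultimately show ?thesis
    using few bad
    by (intro exI[of _ "real (card X)"] exI[of _ "real (card Y)"] exI[of _ w]) auto
qed

section \<open>The optimisation\<close>

text \<open>
  The maximum is attained at \<open>w = s\<close> with \<open>s = \<tau> / sqrt 3\<close>; the difference of the two sides is
  \<open>(w - s)\<^sup>2 (w + 2 s)\<close>.
\<close>

lemma cubic_max:
  fixes w \<tau> :: real
  assumes "0 \<le> w" "0 \<le> \<tau>"
  shows "w * (\<tau>\<^sup>2 - w\<^sup>2) \<le> 2 / (3 * sqrt 3) * \<tau> ^ 3"
proof -
  define s where "s = \<tau> / sqrt 3"
  have \<tau>: "\<tau> = sqrt 3 * s" by (simp add: s_def)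
  have t2: "\<tau>\<^sup>2 = 3 * s\<^sup>2" by (simp add: \<tau> power_mult_distrib)
  have "0 \<le> (w - s)\<^sup>2 * (w + 2 * s)"
    using assms by (intro mult_nonneg_nonneg) (auto simp: s_def)
  also have "\<dots> = 2 * s ^ 3 - w * (\<tau>\<^sup>2 - w\<^sup>2)"
    unfolding t2 by (simp add: power2_eq_square power3_eq_cube algebra_simps)
  also have "2 * s ^ 3 = 2 / (3 * sqrt 3) * \<tau> ^ 3"
  proof -
    have "sqrt 3 ^ 3 = 3 * sqrt 3" by (simp add: power3_eq_cube)
    then show ?thesis by (simp add: s_def power_divide)
  qed
  finally show ?thesis by simp
qed

text \<open>
  The optimisation with lengths scaled by \<open>1/n\<close> and pair counts by \<open>1/n\<^sup>2\<close>, so that \<open>t\<close> becomes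
  \<open>\<beta>\<^sup>6\<close>. Substituting the bound \<open>bad\<close> on \<open>D\<close> for the \<open>D\<close> in the upper bound for \<open>m\<close> turns
  \<open>miss\<close> into \<open>k A + w\<^sup>2 \<le> \<beta>\<^sup>6 + p\<^sup>2 / 2\<close>, where \<open>A\<close> is \<open>1/r\<close> up to a relative error \<open>O(r \<beta>)\<close> that
  comes from the threshold \<open>\<beta>\<close>; all other corrections are of smaller order. Then \<open>cubic_max\<close> bounds \<open>k w\<close>, and the
  remaining part of \<open>bad\<close> is at most \<open>3 p\<^sup>2 / 2 \<le> 24 \<beta>\<^sup>1\<^sup>0\<close>.
\<close>

lemma extremal_estimate_normalised:
  fixes \<beta> L D m s p k w r :: real
  assumes r: "r \<ge> 2" and \<beta>: "0 < \<beta>" "\<beta> * r\<^sup>2 \<le> 1 / 14"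
    and L: "1 / r - 2 * r * \<beta> ^ 3 \<le> L"
    and s: "0 \<le> s" "s\<^sup>2 = m"
    and m: "m \<le> \<beta> ^ 6 + D" and D: "D \<le> \<beta> ^ 6"
    and k: "0 \<le> k" "k \<le> p" and w: "0 \<le> w"
    and p: "p * \<beta> \<le> 2 * m"
    and bad: "D \<le> p\<^sup>2 / 2 + k * (p + w)"
    and miss: "k * (L - s - \<beta>) - k\<^sup>2 / 2 + w\<^sup>2 \<le> m"
  shows "D \<le> (2 * r / (3 * sqrt 3) + 30 * r ^ 3 * \<beta>) * \<beta> ^ 9"
proof -
  \<comment> \<open>A polynomial upper bound for the square root of \<open>\<beta>\<^sup>6 + p\<^sup>2 / 2\<close>.\<close>
  define \<tau> where "\<tau> = \<beta> ^ 3 * (1 + 4 * \<beta> ^ 4)"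
  have r\<beta>: "r * \<beta> \<le> 1 / 28"
  proof -
    have "2 * (r * \<beta>) \<le> r * (r * \<beta>)" using r \<beta> by (intro mult_right_mono) auto
    then show ?thesis using \<beta>(2) by (simp add: power2_eq_square mult_ac)
  qed
  have \<beta>56: "\<beta> \<le> 1 / 56"
  proof -
    have "2 * \<beta> \<le> r * \<beta>" using r \<beta> by (intro mult_right_mono) auto
    then show ?thesis using r\<beta> by simp
  qed
  have pow: "\<beta> ^ c \<le> \<beta> / 3136" if "c \<ge> 3" for c
  proof -
    have "\<beta> ^ c \<le> \<beta> ^ 3" using that \<beta> \<beta>56 by (intro power_decreasing) auto
    also have "\<dots> = \<beta> * \<beta>\<^sup>2" by (simp add: power3_eq_cube power2_eq_square)
    also have "\<dots> \<le> \<beta> * (1 / 56)\<^sup>2" using \<beta> \<beta>56 by (intro mult_left_mono power_mono) auto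
    finally show ?thesis by (simp add: power_divide)
  qed
  have m2: "m \<le> 2 * \<beta> ^ 6" using m D by simp
  have p4: "p \<le> 4 * \<beta> ^ 5"
  proof -
    have "p * \<beta> \<le> (4 * \<beta> ^ 5) * \<beta>" using p m2 by (simp add: eval_nat_numeral)
    then show ?thesis using \<beta>(1) by (rule mult_right_le_imp_le)
  qed
  have small: "x \<le> 3 / 2 * \<beta> ^ 3" if "x\<^sup>2 \<le> 2 * \<beta> ^ 6" for x :: real
  proof (rule power2_le_imp_le)
    have "(3 / 2 * \<beta> ^ 3)\<^sup>2 = 9 / 4 * \<beta> ^ 6"
      by (simp add: power_mult_distrib power_divide flip: power_mult)
    then show "x\<^sup>2 \<le> (3 / 2 * \<beta> ^ 3)\<^sup>2" using that zero_le_power[of \<beta> 6] \<beta>(1) by linarith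
  qed (use \<beta> in auto)
  have s3: "s \<le> 3 / 2 * \<beta> ^ 3" using small s m2 by simp
  have p0: "0 \<le> p" using k by simp
  have kp: "k * p \<le> p\<^sup>2"
    using k p0 by (auto simp: power2_eq_square intro: mult_right_mono)
  have p2: "p\<^sup>2 \<le> 16 * \<beta> ^ 10"
  proof -
    have "p\<^sup>2 \<le> (4 * \<beta> ^ 5)\<^sup>2" using p4 p0 by (rule power_mono)
    then show ?thesis by (simp add: power_mult_distrib flip: power_mult)
  qed
  have \<tau>0: "0 \<le> \<tau>" using \<beta> by (simp add: \<tau>_def)
  have \<tau>2: "\<beta> ^ 6 + p\<^sup>2 / 2 \<le> \<tau>\<^sup>2"
  proof -
    have "\<tau>\<^sup>2 = \<beta> ^ 6 + 8 * \<beta> ^ 10 + 16 * \<beta> ^ 14"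
      unfolding \<tau>_def by (simp add: eval_nat_numeral algebra_simps)
    then show ?thesis using p2 zero_le_power[of \<beta> 14] \<beta>(1) by linarith
  qed
  have w3: "w \<le> 3 / 2 * \<beta> ^ 3" if "0 \<le> L - s - \<beta> - k / 2"
  proof -
    have "0 \<le> k * (L - s - \<beta> - k / 2)" using that k by simp
    then have "w\<^sup>2 \<le> m" using miss by (simp add: power2_eq_square algebra_simps)
    then show ?thesis using small m2 by simp
  qed
  have r\<beta>3: "r * \<beta> ^ 3 \<le> \<beta> / 1568"
  proof -
    have "(r * \<beta>) * \<beta>\<^sup>2 \<le> (1 / 28) * (\<beta> * (1 / 56))"
      using r \<beta> r\<beta> \<beta>56 by (intro mult_mono) (auto simp: power2_eq_square)
    then show ?thesis by (simp add: power2_eq_square power3_eq_cube mult_ac)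
  qed
  have \<beta>3: "\<beta> ^ 3 \<le> \<beta> / 3136" and \<beta>5: "\<beta> ^ 5 \<le> \<beta> / 3136"
    by (simp_all only: pow)
  have rinv: "28 * \<beta> \<le> 1 / r" using r\<beta> r by (simp add: field_simps)
  have "0 \<le> L - s - \<beta> - k / 2"
    using L s3 r\<beta>3 \<beta>3 \<beta>5 p4 k \<beta>(1) rinv by linarith
  from w3[OF this] have w3: "w \<le> 3 / 2 * \<beta> ^ 3" .
  define A where "A = L - s - \<beta> - k / 2 - p - w"
  have A: "1 / r - 2 * \<beta> \<le> A"
    unfolding A_def using L s3 w3 r\<beta>3 \<beta>3 \<beta>5 p4 k \<beta>(1) by linarith
  have kA: "k * A \<le> \<tau>\<^sup>2 - w\<^sup>2"
    using miss m bad \<tau>2 by (simp add: A_def power2_eq_square algebra_simps)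
  define Z where "Z = 2 / (3 * sqrt 3) * r"
  have Z0: "0 \<le> Z" using r by (simp add: Z_def)
  have kw: "k * w \<le> Z * \<beta> ^ 9 * (1 + 6 * r * \<beta>)"
  proof -
    have "(k * w) * (1 - 2 * (r * \<beta>)) = r * (k * w * (1 / r - 2 * \<beta>))"
      using r by (simp add: field_simps)
    also have "\<dots> \<le> r * (k * w * A)"
      using A k w r by (intro mult_left_mono) auto
    also have "\<dots> = r * (w * (k * A))" by (simp add: mult_ac)
    also have "\<dots> \<le> r * (w * (\<tau>\<^sup>2 - w\<^sup>2))"
      using kA w r by (intro mult_left_mono) auto
    also have "\<dots> \<le> r * (2 / (3 * sqrt 3) * \<tau> ^ 3)"
      using cubic_max[OF w \<tau>0] r by (intro mult_left_mono) auto
    also have "\<dots> = Z * \<beta> ^ 9 * (1 + 4 * \<beta> ^ 4) ^ 3"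
      by (simp add: Z_def \<tau>_def power_mult_distrib flip: power_mult)
    also have "\<dots> \<le> Z * \<beta> ^ 9 * (1 + \<beta>)"
    proof (intro mult_left_mono)
      have "(1 + 4 * \<beta> ^ 4) ^ 3 = 1 + 12 * \<beta> ^ 4 + 48 * \<beta> ^ 8 + 64 * \<beta> ^ 12"
        by (simp add: eval_nat_numeral algebra_simps)
      then show "(1 + 4 * \<beta> ^ 4) ^ 3 \<le> 1 + \<beta>"
        using pow[of 4] pow[of 8] pow[of 12] \<beta>(1) by simp
    qed (use Z0 \<beta> in auto)
    finally have 1: "(k * w) * (1 - 2 * (r * \<beta>)) \<le> Z * \<beta> ^ 9 * (1 + \<beta>)" .
    \<comment> \<open>This replaces the division by \<open>1 - 2 r \<beta>\<close> by a factor linear in \<open>r \<beta>\<close>.\<close>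
    have "1 + \<beta> \<le> (1 + 6 * (r * \<beta>)) * (1 - 2 * (r * \<beta>))"
    proof -
      have "(r * \<beta>) * (r * \<beta>) \<le> (1 / 28) * (r * \<beta>)"
        using r\<beta> r \<beta> by (intro mult_right_mono) auto
      moreover have "2 * \<beta> \<le> r * \<beta>" using r \<beta> by (intro mult_right_mono) auto
      moreover have "(1 + 6 * (r * \<beta>)) * (1 - 2 * (r * \<beta>)) = 1 + 4 * (r * \<beta>) - 12 * ((r * \<beta>) * (r * \<beta>))"
        by (simp add: algebra_simps)
      ultimately show ?thesis using \<beta>(1) by linarith
    qed
    then have "Z * \<beta> ^ 9 * (1 + \<beta>) \<le> Z * \<beta> ^ 9 * ((1 + 6 * (r * \<beta>)) * (1 - 2 * (r * \<beta>)))"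
      using Z0 \<beta> by (intro mult_left_mono) auto
    with 1 have "(k * w) * (1 - 2 * (r * \<beta>))
        \<le> (Z * \<beta> ^ 9 * (1 + 6 * (r * \<beta>))) * (1 - 2 * (r * \<beta>))"
      by (simp only: mult.assoc)
    moreover have "0 < 1 - 2 * (r * \<beta>)" using r\<beta> by simp
    ultimately show ?thesis by (simp add: mult_le_cancel_right_pos mult.assoc)
  qed
  have "D \<le> k * w + 24 * \<beta> ^ 10"
    using bad kp p2 by (simp add: algebra_simps)
  also have "\<dots> \<le> Z * \<beta> ^ 9 * (1 + 6 * r * \<beta>) + 24 * \<beta> ^ 10"
    using kw by simp
  also have "\<dots> = Z * \<beta> ^ 9 + (Z * 6 * r + 24) * \<beta> ^ 10"
    by (simp add: eval_nat_numeral algebra_simps)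
  also have "\<dots> \<le> Z * \<beta> ^ 9 + (30 * r ^ 3) * \<beta> ^ 10"
  proof -
    have "1 \<le> sqrt (3::real)" by simp
    then have "2 / (3 * sqrt 3) \<le> (1::real)" by (simp add: field_simps del: real_sqrt_ge_1_iff)
    then have "Z \<le> 1 * r" unfolding Z_def using r by (intro mult_right_mono) auto
    then have "Z * r \<le> r * r" using r by (intro mult_right_mono) auto
    moreover have "2 * (r * r) \<le> r * (r * r)" "2 * 2 \<le> r * r"
      using r by (intro mult_mono; simp)+
    ultimately have "Z * 6 * r + 24 \<le> 30 * r ^ 3"
      by (simp add: power3_eq_cube)
    then show ?thesis using \<beta> by (intro add_left_mono mult_right_mono) auto
  qed
  also have "\<dots> = (2 * r / (3 * sqrt 3) + 30 * r ^ 3 * \<beta>) * \<beta> ^ 9"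
    by (simp add: Z_def eval_nat_numeral algebra_simps)
  finally show ?thesis .
qed

lemma extremal_estimate:
  fixes \<beta> L D m p k w r n :: real
  assumes r: "r \<ge> 2" and \<beta>: "0 < \<beta>" "\<beta> * r\<^sup>2 \<le> 1 / 14" and n: "0 < n" and m0: "0 \<le> m"
    and L: "n / r - 2 * r * \<beta> ^ 3 * n \<le> L"
    and m: "m \<le> \<beta> ^ 6 * n\<^sup>2 + D" and D: "D \<le> \<beta> ^ 6 * n\<^sup>2"
    and k: "0 \<le> k" "k \<le> p" and w: "0 \<le> w"
    and p: "p * (\<beta> * n) \<le> 2 * m"
    and bad: "D \<le> p\<^sup>2 / 2 + k * (p + w)"
    and miss: "k * (L - sqrt m - \<beta> * n) - k\<^sup>2 / 2 + w\<^sup>2 \<le> m"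
  shows "D \<le> (2 * r / (3 * sqrt 3) + 30 * r ^ 3 * \<beta>) * \<beta> ^ 9 * n\<^sup>2"
proof -
  have n2: "0 < n\<^sup>2" using n by simp
  have div: "a / n\<^sup>2 \<le> b / n\<^sup>2" if "a \<le> b" for a b
    using that n2 by (simp add: divide_right_mono)
  have "D / n\<^sup>2 \<le> (2 * r / (3 * sqrt 3) + 30 * r ^ 3 * \<beta>) * \<beta> ^ 9"
  proof (rule extremal_estimate_normalised[OF r \<beta>, where L = "L / n" and m = "m / n\<^sup>2" and s = "sqrt m / n"
        and p = "p / n" and k = "k / n" and w = "w / n"])
    show "1 / r - 2 * r * \<beta> ^ 3 \<le> L / n" using L n r by (simp add: field_simps)
    show "0 \<le> sqrt m / n" "(sqrt m / n)\<^sup>2 = m / n\<^sup>2" using m0 n by (auto simp: power_divide)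
    show "m / n\<^sup>2 \<le> \<beta> ^ 6 + D / n\<^sup>2" "D / n\<^sup>2 \<le> \<beta> ^ 6" using m D n2 by (auto simp: field_simps)
    show "0 \<le> k / n" "k / n \<le> p / n" "0 \<le> w / n" using k w n by (auto simp: divide_right_mono)
    show "p / n * \<beta> \<le> 2 * (m / n\<^sup>2)"
      using div[OF p] n by (simp add: power2_eq_square)
    have "(p\<^sup>2 / 2 + k * (p + w)) / n\<^sup>2 = (p / n)\<^sup>2 / 2 + k / n * (p / n + w / n)"
      using n by (simp add: power2_eq_square field_simps)
    with div[OF bad] show "D / n\<^sup>2 \<le> (p / n)\<^sup>2 / 2 + k / n * (p / n + w / n)" by simp
    have "(k * (L - sqrt m - \<beta> * n) - k\<^sup>2 / 2 + w\<^sup>2) / n\<^sup>2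
        = k / n * (L / n - sqrt m / n - \<beta>) - (k / n)\<^sup>2 / 2 + (w / n)\<^sup>2"
      using n by (simp add: power2_eq_square field_simps)
    with div[OF miss] show "k / n * (L / n - sqrt m / n - \<beta>) - (k / n)\<^sup>2 / 2 + (w / n)\<^sup>2 \<le> m / n\<^sup>2"
      by simp
  qed
  then show ?thesis using n2 by (simp add: pos_divide_le_eq)
qed

section \<open>The stability theorem\<close>

theorem theorem1p3:
  fixes r n :: nat and \<alpha> t :: real and V :: "'a set" and E :: "'a set set"
  assumes "r \<ge> 2"
    and "n \<ge> 3 * r ^ 2"
    and "0 \<le> \<alpha>" and "\<alpha> \<le> 10 powi (-7) * real r powi (-12)"
    and "simple_graph V E" and "card V = n" and "clique_free (r + 1) V E"
    and "t = \<alpha> * real n ^ 2"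
    and "real (card E) \<ge> real (turan_number n (r + 1)) - t"
  shows "real (partite_distance r V E)
           \<le> (2 * real r / (3 * sqrt 3) + 30 * real r ^ 3 * \<alpha> powr (1 / 6))
              * \<alpha> powr (3 / 2) * real n ^ 2"
proof -
  have finV: "finite V" using assms(5) by (simp add: simple_graph_def)
  have finE: "finite E" using simple_graph_finite_edges[OF assms(5)] .
  obtain g where g: "g ` V \<subseteq> {..<r}"
    "card E + card (E - cross_pairs V g) \<le> card (cross_pairs V g)"
    using furedi_colouring[OF assms(5,7)] by (elim exE conjE)
  obtain f where f: "f ` V \<subseteq> {..<r}"
    and opt: "\<And>g. g ` V \<subseteq> {..<r} \<Longrightarrow> card (E - cross_pairs V f) \<le> card (E - cross_pairs V g)"
    using ex_has_least_nat[of "\<lambda>f. f ` V \<subseteq> {..<r}" g "\<lambda>f. card (E - cross_pairs V f)"] g(1)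
    by auto
  define D where "D = real (card (E - cross_pairs V f))"
  define m where "m = real (card (cross_pairs V f - E))"
  have dist: "real (partite_distance r V E) \<le> D"
    unfolding D_def using partite_distance_le_card_monochromatic[OF assms(5) f] by simp
  have D0: "0 \<le> D" and m0: "0 \<le> m" by (simp_all add: D_def m_def)
  have ex: "card (cross_pairs V f') \<le> turan_number n (r + 1)" if "f' ` V \<subseteq> {..<r}" for f'
    using card_cross_pairs_le_turan_number[OF finV that] assms(6) by simp
  \<comment> \<open>Optimality transfers the bound from the colouring \<open>g\<close> to \<open>f\<close>.\<close>
  have Dt: "D \<le> t"
    using opt[OF g(1)] g(2) ex[OF g(1)] assms(9) unfolding D_def by linarith
  have balance: "real (card (cross_pairs V f)) + D = real (card E) + m"
  proof -
    have "card (cross_pairs V f) = card (cross_pairs V f \<inter> E) + card (cross_pairs V f - E)"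
      by (rule card_Int_Diff) (rule finite_cross_pairs[OF finV])
    moreover have "card E = card (E \<inter> cross_pairs V f) + card (E - cross_pairs V f)"
      by (rule card_Int_Diff) (rule finE)
    ultimately show ?thesis by (simp add: D_def m_def Int_commute)
  qed
  have mtD: "m \<le> t + D"
    using balance ex[OF f] assms(9) by linarith
  define \<beta> where "\<beta> = \<alpha> powr (1 / 6)"
  have \<beta>0: "0 \<le> \<beta>" by (simp add: \<beta>_def)
  have \<beta>6: "\<beta> ^ 6 = \<alpha>" and \<beta>9: "\<alpha> powr (3 / 2) = \<beta> ^ 9"
    using assms(3) by (cases "\<alpha> = 0"; simp add: \<beta>_def powr_powr flip: powr_realpow')+
  have bound: "D \<le> (2 * real r / (3 * sqrt 3) + 30 * real r ^ 3 * \<beta>) * \<beta> ^ 9 * real n ^ 2"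
  \<comment> \<open>If \<open>t < 1\<close>, the graph has no monochromatic edge, since \<open>D\<close> is a natural number below \<open>1\<close>.
    Otherwise \<open>t \<ge> 1\<close> absorbs the rounding errors in the class sizes.\<close>
  proof (cases "t < 1")
    case True
    then have "D = 0" using Dt by (simp add: D_def)
    then show ?thesis using \<beta>0 by simp
  next
    case False
    then have t1: "1 \<le> t" by simp
    then have "\<alpha> \<noteq> 0" using assms(8) by auto
    moreover have "n \<noteq> 0" using assms(8) t1 by (cases n) auto
    ultimately have n0: "0 < real n" and \<beta>pos: "0 < \<beta>" by (simp_all add: \<beta>_def)
    have r2: "2 \<le> real r" using assms(1) by simp
    have t\<beta>: "t = \<beta> ^ 6 * (real n)\<^sup>2" using assms(8) \<beta>6 by simp
    \<comment> \<open>The numerical hypothesis on \<open>\<alpha>\<close> is used in this form, which holds as \<open>14\<^sup>6 \<le> 10\<^sup>7\<close>.\<close>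
    have \<beta>r: "\<beta> * (real r)\<^sup>2 \<le> 1 / 14"
    proof (rule power_le_imp_le_base[of _ 5])
      have "(\<beta> * (real r)\<^sup>2) ^ 6 = \<alpha> * real r ^ 12"
        by (simp add: power_mult_distrib \<beta>6 flip: power_mult)
      also have "\<dots> \<le> (10 powi (-7) * real r powi (-12)) * real r ^ 12"
        using assms(4) by (intro mult_right_mono) auto
      also have "\<dots> = 1 / 10 ^ 7"
        using assms(1) by (simp add: power_int_minus field_simps)
      also have "\<dots> \<le> (1 / 14) ^ 6" by (simp add: power_divide)
      finally show "(\<beta> * (real r)\<^sup>2) ^ Suc 5 \<le> (1 / 14) ^ Suc 5" by simp
    qed simp
    \<comment> \<open>The allowance for unbalanced classes only has to be small compared to \<open>\<beta> n\<close>, the threshold for bad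
      vertices; \<open>2 r \<beta>\<^sup>3 n\<close> also covers the rounding loss, because \<open>4 t + r \<le> 4 r\<^sup>2 t\<close>.\<close>
    define L where "L = real n / real r - 2 * real r * \<beta> ^ 3 * real n"
    have sizes: "L \<le> real (card (colour_class V f j))" if "j < r" for j
    proof -
      let ?d = "real (card (colour_class V f j)) - real n / real r"
      have "real (turan_number (card V) (r + 1)) - 2 * t \<le> real (card (cross_pairs V f))"
        using balance Dt m0 assms(6,9) by simp
      then have "?d\<^sup>2 \<le> 2 * (2 * t) + real r"
        unfolding assms(6)[symmetric] by (rule colour_class_near_average[OF finV f that])
      also have "\<dots> \<le> (4 + real r) * t"
        using t1 mult_left_mono[of 1 t "real r"] by (simp add: algebra_simps)
      also have "\<dots> \<le> (2 * real r)\<^sup>2 * t"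
      proof (rule mult_right_mono)
        have "2 * real r \<le> real r * real r" using r2 by (intro mult_right_mono) auto
        then show "4 + real r \<le> (2 * real r)\<^sup>2"
          using r2 unfolding power2_eq_square by linarith
      qed (use t1 in simp)
      also have "\<dots> = (2 * real r * \<beta> ^ 3 * real n)\<^sup>2"
        by (simp add: t\<beta> power_mult_distrib flip: power_mult)
      finally have "\<bar>?d\<bar> \<le> 2 * real r * \<beta> ^ 3 * real n"
        using \<beta>0 by (subst (asm) abs_le_square_iff[symmetric]) simp
      then show ?thesis by (simp add: L_def)
    qed
    have sm: "sqrt m \<le> 3 / 2 * \<beta> ^ 3 * real n"
    proof (rule real_le_lsqrt)
      have "m \<le> 2 * t" using mtD Dt by simp
      also have "\<dots> \<le> 9 / 4 * t" using t1 by simp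
      also have "\<dots> = (3 / 2 * \<beta> ^ 3 * real n)\<^sup>2"
        by (simp add: t\<beta> power_mult_distrib power_divide flip: power_mult)
      finally show "m \<le> (3 / 2 * \<beta> ^ 3 * real n)\<^sup>2" .
    qed (use m0 \<beta>0 in auto)
    have gap: "sqrt m + 2 * (\<beta> * real n) < L"
    proof -
      have r\<beta>: "real r * \<beta> \<le> 1 / 28"
      proof -
        have "2 * (real r * \<beta>) \<le> real r * (real r * \<beta>)"
          using r2 \<beta>0 by (intro mult_right_mono) auto
        then show ?thesis using \<beta>r by (simp add: power2_eq_square mult_ac)
      qed
      have \<beta>1: "\<beta> \<le> 1"
        using mult_right_mono[OF r2 \<beta>0] r\<beta> by simp
      have \<beta>2: "\<beta>\<^sup>2 \<le> 1" using \<beta>0 \<beta>1 by (simp add: power_le_one)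
      have "real r * (3 / 2 * \<beta> ^ 3 + 2 * \<beta> + 2 * real r * \<beta> ^ 3)
          = real r * \<beta> * (3 / 2 * \<beta>\<^sup>2 + 2 + 2 * (real r * \<beta>) * \<beta>)"
        by (simp add: power2_eq_square power3_eq_cube algebra_simps)
      also have "\<dots> \<le> 1 / 28 * (3 / 2 * 1 + 2 + 2 * (1 / 28) * 1)"
        using r\<beta> \<beta>0 \<beta>1 \<beta>2 by (intro mult_mono add_mono) auto
      also have "\<dots> < 1" by simp
      finally have "3 / 2 * \<beta> ^ 3 + 2 * \<beta> + 2 * real r * \<beta> ^ 3 < 1 / real r"
        using r2 by (simp add: field_simps)
      then have "(3 / 2 * \<beta> ^ 3 + 2 * \<beta> + 2 * real r * \<beta> ^ 3) * real n < 1 / real r * real n"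
        using n0 by (intro mult_strict_right_mono)
      then show ?thesis using sm by (simp add: L_def algebra_simps)
    qed
    have "\<exists>p k w. 0 \<le> k \<and> k \<le> p \<and> 0 \<le> w \<and> p * (\<beta> * real n) \<le> 2 * m
        \<and> D \<le> p\<^sup>2 / 2 + k * (p + w)
        \<and> k * (L - sqrt m - \<beta> * real n) - k\<^sup>2 / 2 + w\<^sup>2 \<le> m"
      unfolding m_def D_def
      by (rule optimal_colouring_inequalities[OF assms(5,7) f assms(1)])
        (use opt sizes gap in \<open>auto simp: m_def\<close>)
    then obtain p k w where *: "0 \<le> k" "k \<le> p" "0 \<le> w" "p * (\<beta> * real n) \<le> 2 * m"
      "D \<le> p\<^sup>2 / 2 + k * (p + w)"
      "k * (L - sqrt m - \<beta> * real n) - k\<^sup>2 / 2 + w\<^sup>2 \<le> m"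
      by (elim exE conjE)
    show ?thesis
      by (rule extremal_estimate[OF r2 \<beta>pos \<beta>r n0 m0 _ _ _ *(1,2,3,4,5,6)])
        (use mtD Dt t\<beta> in \<open>simp_all add: L_def\<close>)
  qed
  show ?thesis using dist bound unfolding \<beta>9 \<beta>_def[symmetric] by linarith
qed

end
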